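(* If a group $G$ is not hereditarily conjugacy separable, then $G$ has an overgroup $K$, with $|K:G|<\infty$, such that $K$ is not conjugacy separable.
   Context: An overgroup of $G$ is a group containing $G$ as a subgroup. A group $A$ is conjugacy separable if for any two non-conjugate elements $x,y\in A$ there is a homomorphism $\varphi$ from $A$ to a finite group $M$ such that $\varphi(x)$ and $\varphi(y)$ are not conjugate in $M$; $A$ is hereditarily conjugacy separable if every finite index subgroup of $A$ (including $A$ itself) is conjugacy separable. *)

theory Defs
  imports "HOL-Algebra.Algebra"
begin

definition conjugate_in :: "('a, 'm) monoid_scheme \<Rightarrow> 'a \<Rightarrow> 'a \<Rightarrow> bool"
  where "conjugate_in A x y \<longleftrightarrow> (\<exists>g\<in>carrier A. y = g \<otimes>\<^bsub>A\<^esub> x \<otimes>\<^bsub>A\<^esub> inv\<^bsub>A\<^esub> g)"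

definition finite_index :: "'a set \<Rightarrow> ('a, 'm) monoid_scheme \<Rightarrow> bool"
  where "finite_index H A \<longleftrightarrow> subgroup H A \<and> finite (rcosets\<^bsub>A\<^esub> H)"

text \<open>
  HOL cannot quantify existentially over types. Every finite group is isomorphic to one whose
  carrier consists of natural numbers, so letting the finite group \<open>M\<close> below range over groups on
  type \<^typ>\<open>nat\<close> is no restriction; see \<open>finite_group_witness_nat\<close>.
\<close>

definition conjugacy_separable :: "('a, 'm) monoid_scheme \<Rightarrow> bool"
  where "conjugacy_separable A \<longleftrightarrow>
    (\<forall>x\<in>carrier A. \<forall>y\<in>carrier A. \<not> conjugate_in A x y \<longrightarrow>
      (\<exists>(M :: nat monoid) \<phi>. group M \<and> finite (carrier M) \<and> \<phi> \<in> hom A M \<and>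
         \<not> conjugate_in M (\<phi> x) (\<phi> y)))"

definition hereditarily_conjugacy_separable :: "('a, 'm) monoid_scheme \<Rightarrow> bool"
  where "hereditarily_conjugacy_separable A \<longleftrightarrow>
    (\<forall>H. finite_index H A \<longrightarrow> conjugacy_separable (A\<lparr>carrier := H\<rparr>))"

text \<open>
  A group containing \<open>G\<close> as a subgroup need not fit into the type of \<open>G\<close>, whose elements may
  already exhaust that type. Hence an overgroup \<open>K\<close> comes with the inclusion \<open>\<iota>\<close> of \<open>G\<close>, an
  injective homomorphism, and \<open>G\<close> is identified with its image.
\<close>

definition overgroup_via ::
    "('a, 'm) monoid_scheme \<Rightarrow> ('a \<Rightarrow> 'k) \<Rightarrow> ('k, 'n) monoid_scheme \<Rightarrow> bool"
  where "overgroup_via G \<iota> K \<longleftrightarrow> group K \<and> \<iota> \<in> mon G K"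

lemma finite_group_witness_nat:
  fixes A :: "('a, 'm) monoid_scheme" and M :: "('b, 'n) monoid_scheme"
  assumes "group M" "finite (carrier M)" "\<phi> \<in> hom A M"
    and xy: "x \<in> carrier A" "y \<in> carrier A" and nc: "\<not> conjugate_in M (\<phi> x) (\<phi> y)"
  shows "\<exists>(N :: nat monoid) \<psi>. group N \<and> finite (carrier N) \<and> \<psi> \<in> hom A N \<and>
           \<not> conjugate_in N (\<psi> x) (\<psi> y)"
proof -
  interpret M: group M by fact
  obtain f :: "'b \<Rightarrow> nat" where f: "inj_on f (carrier M)"
    using finite_imp_inj_to_nat_seg[OF assms(2)] by blast
  let ?N = "image_group f M"
  have N: "group ?N" by (rule M.inj_imp_image_group_is_group[OF f])
  have fh: "f \<in> hom M ?N"
    using f by (auto simp: hom_def image_group_def)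
  interpret f: group_hom M ?N f
    by (simp add: group_hom_def group_hom_axioms_def N fh M.group_axioms)
  have px: "\<phi> x \<in> carrier M" "\<phi> y \<in> carrier M"
    using assms(3) xy by (auto simp: hom_def)
  have "\<not> conjugate_in ?N (f (\<phi> x)) (f (\<phi> y))"
  proof
    assume "conjugate_in ?N (f (\<phi> x)) (f (\<phi> y))"
    then obtain g where g: "g \<in> carrier M"
      and "f (\<phi> y) = f g \<otimes>\<^bsub>?N\<^esub> f (\<phi> x) \<otimes>\<^bsub>?N\<^esub> inv\<^bsub>?N\<^esub> (f g)"
      by (auto simp: conjugate_in_def image_group_carrier)
    then have "f (\<phi> y) = f (g \<otimes>\<^bsub>M\<^esub> \<phi> x \<otimes>\<^bsub>M\<^esub> inv\<^bsub>M\<^esub> g)"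
      using px by simp
    then have "\<phi> y = g \<otimes>\<^bsub>M\<^esub> \<phi> x \<otimes>\<^bsub>M\<^esub> inv\<^bsub>M\<^esub> g"
      by (rule inj_onD[OF f]) (use g px in simp_all)
    with g nc show False by (auto simp: conjugate_in_def)
  qed
  moreover have "f \<circ> \<phi> \<in> hom A ?N"
    using assms(3) fh by (rule hom_compose)
  moreover have "finite (carrier ?N)"
    using assms(2) by (simp add: image_group_carrier)
  ultimately show ?thesis using N by (intro exI[of _ ?N] exI[of _ "f \<circ> \<phi>"]) simp
qed

text \<open>
  Every overgroup of finite index has an isomorphic copy (its \<^const>\<open>image_group\<close>) on the type
  \<^typ>\<open>'a \<times> nat\<close>, where \<^typ>\<open>'a\<close> is the type of \<open>G\<close>. A search for overgroups of finite index
  can therefore be confined to that type.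
\<close>

lemma finite_index_overgroup_inj:
  fixes G :: "('a, 'm) monoid_scheme" and K :: "('k, 'n) monoid_scheme"
  assumes K: "overgroup_via G \<iota> K" and fin: "finite_index (\<iota> ` carrier G) K"
  shows "\<exists>f :: 'k \<Rightarrow> 'a \<times> nat. inj_on f (carrier K)"
proof -
  interpret K: group K using K by (simp add: overgroup_via_def)
  let ?H = "\<iota> ` carrier G"
  have H: "subgroup ?H K" using fin by (simp add: finite_index_def)
  obtain e :: "'k set \<Rightarrow> nat" where e: "inj_on e (rcosets\<^bsub>K\<^esub> ?H)"
    using fin finite_imp_inj_to_nat_seg by (metis finite_index_def)
  have in_rc: "?H #>\<^bsub>K\<^esub> x \<in> rcosets\<^bsub>K\<^esub> ?H" if "x \<in> carrier K" for x
    using that by (auto simp: RCOSETS_def)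
  have "\<exists>r. r \<in> carrier K \<and> C = ?H #>\<^bsub>K\<^esub> r" if "C \<in> rcosets\<^bsub>K\<^esub> ?H" for C
    using that by (auto simp: RCOSETS_def)
  then obtain r where r: "\<And>C. C \<in> rcosets\<^bsub>K\<^esub> ?H \<Longrightarrow> r C \<in> carrier K \<and> C = ?H #>\<^bsub>K\<^esub> r C"
    by metis
  have "\<exists>g. g \<in> carrier G \<and> x = \<iota> g \<otimes>\<^bsub>K\<^esub> r (?H #>\<^bsub>K\<^esub> x)" if x: "x \<in> carrier K" for x
  proof -
    have "x \<in> ?H #>\<^bsub>K\<^esub> x" using H x by (rule K.rcos_self[rotated])
    then have "x \<in> ?H #>\<^bsub>K\<^esub> r (?H #>\<^bsub>K\<^esub> x)" using r[OF in_rc[OF x]] by simp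
    then show ?thesis by (auto simp: r_coset_def)
  qed
  then obtain g where g: "\<And>x. x \<in> carrier K \<Longrightarrow> x = \<iota> (g x) \<otimes>\<^bsub>K\<^esub> r (?H #>\<^bsub>K\<^esub> x)"
    by metis
  have "inj_on (\<lambda>x. (g x, e (?H #>\<^bsub>K\<^esub> x))) (carrier K)"
  proof (rule inj_onI)
    fix x y
    assume xy: "x \<in> carrier K" "y \<in> carrier K"
      and eq: "(g x, e (?H #>\<^bsub>K\<^esub> x)) = (g y, e (?H #>\<^bsub>K\<^esub> y))"
    then have "?H #>\<^bsub>K\<^esub> x = ?H #>\<^bsub>K\<^esub> y"
      using e in_rc by (auto dest: inj_onD)
    then show "x = y" using g[OF xy(1)] g[OF xy(2)] eq by simp
  qed
  then show ?thesis by blast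
qed

end

theory Submission
  imports Defs
begin

text \<open>
  Let \<open>H\<close> be a finite-index subgroup of \<open>G\<close> which is not conjugacy separable, and let
  \<open>x, y \<in> H\<close> be non-conjugate in \<open>H\<close> but conjugate in all finite quotients of \<open>H\<close>. Take for \<open>K\<close>
  the permutational wreath product of the group of order two with \<open>G\<close> acting on the cosets of
  \<open>H\<close>. Lighting the single lamp at the coset \<open>H\<close> marks \<open>x\<close> and \<open>y\<close>: since both fix this coset,
  the lamp there cannot be changed by conjugation with lamp configurations, so any element
  conjugating \<open>(H, x)\<close> to \<open>(H, y)\<close> has its \<open>G\<close>-component in \<open>H\<close>, and the marked elements are not
  conjugate in \<open>K\<close>. Elements of \<open>H\<close> fix the lit lamp, so in a finite quotient of \<open>K\<close> the marked
  elements are conjugate as soon as the images of \<open>x\<close> and \<open>y\<close> are conjugate in the image of \<open>H\<close>.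
\<close>

section \<open>Transport along isomorphisms\<close>

lemma hom_conjugate_in:
  assumes "group A" "group B" "\<phi> \<in> hom A B" "x \<in> carrier A" "conjugate_in A x y"
  shows "conjugate_in B (\<phi> x) (\<phi> y)"
proof -
  interpret group_hom A B \<phi>
    using assms by (simp add: group_hom_def group_hom_axioms_def)
  show ?thesis
    using assms(4,5) by (auto simp: conjugate_in_def)
qed

text \<open>Conjugacy pulls back along the inverse of \<open>f\<close>, and a finite quotient
  separating the images gives one of \<open>A\<close> by composition with \<open>f\<close>.\<close>

lemma conjugacy_separable_iso:
  assumes "group A" "group B" and f: "f \<in> iso A B" and B: "conjugacy_separable B"
  shows "conjugacy_separable A"
  unfolding conjugacy_separable_def
proof (intro ballI impI)
  fix x y assume xy: "x \<in> carrier A" "y \<in> carrier A" and nc: "\<not> conjugate_in A x y"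
  have fh: "f \<in> hom A B" using f by (simp add: iso_def)
  then have fxy: "f x \<in> carrier B" "f y \<in> carrier B" using xy by (auto simp: hom_def)
  let ?g = "inv_into (carrier A) f"
  have gh: "?g \<in> hom B A"
    using group.iso_set_sym[OF assms(1) f] by (simp add: iso_def)
  have "?g (f x) = x" "?g (f y) = y"
    using f xy by (auto simp: iso_def bij_betw_def)
  then have "\<not> conjugate_in B (f x) (f y)"
    using hom_conjugate_in[OF assms(2,1) gh fxy(1)] nc by metis
  then obtain M :: "nat monoid" and \<phi> where "group M" "finite (carrier M)" "\<phi> \<in> hom B M"
    "\<not> conjugate_in M (\<phi> (f x)) (\<phi> (f y))"
    using B fxy unfolding conjugacy_separable_def by blast
  moreover have "\<phi> \<circ> f \<in> hom A M" using fh \<open>\<phi> \<in> hom B M\<close> by (rule hom_compose)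
  ultimately show "\<exists>(M :: nat monoid) \<phi>. group M \<and> finite (carrier M) \<and> \<phi> \<in> hom A M \<and>
         \<not> conjugate_in M (\<phi> x) (\<phi> y)"
    by (intro exI[of _ M] exI[of _ "\<phi> \<circ> f"]) simp
qed

text \<open>The coset of \<open>f a\<close> is the image of the coset of \<open>a\<close>, so
  passing to the copy creates no further cosets.\<close>

lemma finite_index_image_group:
  assumes "group A" and f: "inj_on f (carrier A)" and H: "finite_index H A"
  shows "finite_index (f ` H) (image_group f A)"
proof -
  interpret A: group A by fact
  let ?B = "image_group f A"
  interpret B: group ?B by (rule A.inj_imp_image_group_is_group[OF f])
  have sub: "subgroup H A" using H by (simp add: finite_index_def)
  have fh: "f \<in> hom A ?B"
    using f by (auto simp: hom_def image_group_def)
  interpret f: group_hom A ?B f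
    by (simp add: group_hom_def group_hom_axioms_def fh A.group_axioms B.group_axioms)
  have "f ` H #>\<^bsub>?B\<^esub> f a = f ` (H #>\<^bsub>A\<^esub> a)" if "a \<in> carrier A" for a
  proof -
    have "f h \<otimes>\<^bsub>?B\<^esub> f a = f (h \<otimes>\<^bsub>A\<^esub> a)" if "h \<in> H" for h
      using that \<open>a \<in> carrier A\<close> subgroup.mem_carrier[OF sub] by simp
    then show ?thesis by (simp add: r_coset_def image_UN)
  qed
  then have "rcosets\<^bsub>?B\<^esub> (f ` H) \<subseteq> (`) f ` (rcosets\<^bsub>A\<^esub> H)"
    by (auto simp: RCOSETS_def image_group_carrier)
  moreover have "finite (rcosets\<^bsub>A\<^esub> H)" using H by (simp add: finite_index_def)
  ultimately show ?thesis
    using f.subgroup_img_is_subgroup[OF sub] by (auto simp: finite_index_def intro: finite_subset)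
qed

text \<open>The wreath product lives on \<open>'a set \<times> 'a\<close>, whereas the theorem asks
  for a group on \<open>'a \<times> nat\<close>; this lemma supplies a copy there.\<close>

lemma finite_index_overgroup_on_prod_nat:
  fixes G :: "('a, 'm) monoid_scheme" and K :: "('k, 'n) monoid_scheme"
  assumes K: "overgroup_via G \<iota> K" and fin: "finite_index (\<iota> ` carrier G) K"
    and ncs: "\<not> conjugacy_separable K"
  shows "\<exists>(L :: ('a \<times> nat) monoid) \<kappa>. overgroup_via G \<kappa> L \<and>
           finite_index (\<kappa> ` carrier G) L \<and> \<not> conjugacy_separable L"
proof -
  interpret K: group K using K by (simp add: overgroup_via_def)
  obtain f :: "'k \<Rightarrow> 'a \<times> nat" where f: "inj_on f (carrier K)"
    using finite_index_overgroup_inj[OF K fin] by blast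
  let ?L = "image_group f K"
  have L: "group ?L" by (rule K.inj_imp_image_group_is_group[OF f])
  have iso: "f \<in> iso K ?L" by (rule inj_imp_image_group_iso[OF f])
  have \<iota>: "\<iota> \<in> hom G K" "inj_on \<iota> (carrier G)"
    using K by (auto simp: overgroup_via_def mon_def)
  have "f \<circ> \<iota> \<in> hom G ?L" using \<iota>(1) iso by (auto simp: iso_def intro: hom_compose)
  moreover have "inj_on (f \<circ> \<iota>) (carrier G)"
    using \<iota> by (intro comp_inj_on inj_on_subset[OF f]) (auto simp: hom_def)
  ultimately have "overgroup_via G (f \<circ> \<iota>) ?L" using L by (simp add: overgroup_via_def mon_def)
  moreover have "finite_index ((f \<circ> \<iota>) ` carrier G) ?L"
    using finite_index_image_group[OF K.group_axioms f fin] by (simp add: image_comp)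
  moreover have "\<not> conjugacy_separable ?L"
    using conjugacy_separable_iso[OF K.group_axioms L iso] ncs by blast
  ultimately show ?thesis by (intro exI[of _ ?L] exI[of _ "f \<circ> \<iota>"]) simp
qed

section \<open>The wreath product\<close>

text \<open>
  A set of cosets \<open>H g\<close> is encoded by its union, so lamp configurations are subsets of
  \<open>G\<close> invariant under left multiplication by \<open>H\<close>; they are added by symmetric difference.
\<close>

definition lamps :: "('a, 'm) monoid_scheme \<Rightarrow> 'a set \<Rightarrow> 'a set set"
  where "lamps G H = {S. S \<subseteq> carrier G \<and> (\<forall>h\<in>H. \<forall>s\<in>S. h \<otimes>\<^bsub>G\<^esub> s \<in> S)}"

text \<open>The semidirect product of the configurations with \<open>G\<close>. Right cosets of
  \<open>H\<close> are permuted by right multiplication; translating by \<open>inv g\<close> instead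
  of \<open>g\<close> makes this a left action.\<close>

definition lamplighter :: "('a, 'm) monoid_scheme \<Rightarrow> 'a set \<Rightarrow> ('a set \<times> 'a) monoid"
  where "lamplighter G H =
    \<lparr>carrier = lamps G H \<times> carrier G,
     monoid.mult = (\<lambda>(S, g) (T, h). (sym_diff S (T #>\<^bsub>G\<^esub> inv\<^bsub>G\<^esub> g), g \<otimes>\<^bsub>G\<^esub> h)),
     one = ({}, \<one>\<^bsub>G\<^esub>)\<rparr>"

context group
begin

lemma mem_r_coset_inv:
  assumes "S \<subseteq> carrier G" "g \<in> carrier G" "a \<in> carrier G"
  shows "a \<in> S #> inv g \<longleftrightarrow> a \<otimes> g \<in> S"
proof
  assume "a \<in> S #> inv g"
  then obtain s where "s \<in> S" "a = s \<otimes> inv g" by (auto simp: r_coset_def)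
  then show "a \<otimes> g \<in> S" using assms by (auto simp: m_assoc subsetD)
next
  assume "a \<otimes> g \<in> S"
  moreover have "a = a \<otimes> g \<otimes> inv g" using assms by (simp add: m_assoc)
  ultimately show "a \<in> S #> inv g" unfolding r_coset_def by blast
qed

text \<open>Right translation is injective, hence commutes with set difference. Thus
  \<open>G\<close> acts on configurations by automorphisms, as associativity requires.\<close>

lemma sym_diff_r_coset:
  assumes "S \<subseteq> carrier G" "T \<subseteq> carrier G" "g \<in> carrier G"
  shows "sym_diff S T #> g = sym_diff (S #> g) (T #> g)"
proof -
  have "inj_on (\<lambda>x. x \<otimes> g) (carrier G)" using assms(3) by (simp add: inj_on_def)
  moreover have "A #> g = (\<lambda>x. x \<otimes> g) ` A" for A by (auto simp: r_coset_def)
  ultimately show ?thesis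
    using assms(1,2) by (simp add: image_Un inj_on_image_set_diff[of _ "carrier G"] Diff_subset[THEN subset_trans])
qed

context
  fixes H assumes H: "subgroup H G"
begin

section \<open>Lamp configurations\<close>

lemma lamps_carrier: "S \<in> lamps G H \<Longrightarrow> S \<subseteq> carrier G"
  by (simp add: lamps_def)

text \<open>\<open>H\<close> contains inverses, so the closure condition in \<open>lamps\<close> can
  be undone.\<close>

lemma lamps_iff:
  assumes "S \<in> lamps G H" "h \<in> H" "s \<in> carrier G"
  shows "h \<otimes> s \<in> S \<longleftrightarrow> s \<in> S"
proof
  assume "h \<otimes> s \<in> S"
  then have "inv h \<otimes> (h \<otimes> s) \<in> S"
    using assms subgroup.m_inv_closed[OF H] by (auto simp: lamps_def)
  then show "s \<in> S" using assms subgroup.mem_carrier[OF H] by (simp add: m_assoc[symmetric])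
qed (use assms in \<open>auto simp: lamps_def\<close>)

lemma empty_in_lamps: "{} \<in> lamps G H"
  by (simp add: lamps_def)

lemma subgroup_in_lamps: "H \<in> lamps G H"
  using subgroup.subset[OF H] subgroup.m_closed[OF H] by (auto simp: lamps_def)

lemma sym_diff_in_lamps:
  assumes "S \<in> lamps G H" "T \<in> lamps G H"
  shows "sym_diff S T \<in> lamps G H"
proof -
  have "h \<otimes> s \<in> sym_diff S T" if "h \<in> H" "s \<in> sym_diff S T" for h s
  proof -
    have "s \<in> carrier G" using that(2) assms[THEN lamps_carrier] by blast
    then show ?thesis using that assms[THEN lamps_iff] by simp
  qed
  then show ?thesis using assms[THEN lamps_carrier] by (auto simp: lamps_def)
qed

lemma r_coset_in_lamps:
  assumes "S \<in> lamps G H" "g \<in> carrier G"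
  shows "S #> g \<in> lamps G H"
proof -
  have "h \<otimes> a \<in> S #> g" if h: "h \<in> H" and a: "a \<in> S #> g" for h a
  proof -
    obtain s where s: "s \<in> S" "a = s \<otimes> g" using a by (auto simp: r_coset_def)
    then have "h \<otimes> a = (h \<otimes> s) \<otimes> g"
      using assms h lamps_carrier subgroup.mem_carrier[OF H] by (simp add: m_assoc subset_iff)
    moreover have "h \<otimes> s \<in> S" using assms(1) h s(1) by (simp add: lamps_def)
    ultimately show ?thesis by (auto simp: r_coset_def)
  qed
  then show ?thesis
    using r_coset_subset_G[OF lamps_carrier] assms by (simp add: lamps_def)
qed

text \<open>A configuration is the union of the cosets it contains, so the subsets of the finite set
  of cosets account for all configurations.\<close>

lemma finite_lamps:
  assumes "finite (rcosets H)"
  shows "finite (lamps G H)"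
proof -
  have "S = \<Union>{C \<in> rcosets H. C \<subseteq> S}" if S: "S \<in> lamps G H" for S
  proof
    show "S \<subseteq> \<Union>{C \<in> rcosets H. C \<subseteq> S}"
    proof
      fix s assume s: "s \<in> S"
      then have sG: "s \<in> carrier G" using S by (auto simp: lamps_def)
      have "H #> s \<subseteq> S" using S s by (auto simp: lamps_def r_coset_def)
      moreover have "H #> s \<in> rcosets H" using sG by (auto simp: RCOSETS_def)
      moreover have "s \<in> H #> s" by (rule rcos_self[OF sG H])
      ultimately show "s \<in> \<Union>{C \<in> rcosets H. C \<subseteq> S}" by blast
    qed
  qed blast
  then have "lamps G H \<subseteq> Union ` Pow (rcosets H)" by blast
  then show ?thesis using assms by (auto intro: finite_subset)
qed

section \<open>The wreath product as an overgroup of finite index\<close>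

lemma lamplighter_carrier: "carrier (lamplighter G H) = lamps G H \<times> carrier G"
  by (simp add: lamplighter_def)

lemma lamplighter_mult:
  "(S, g) \<otimes>\<^bsub>lamplighter G H\<^esub> (T, h) = (sym_diff S (T #> inv g), g \<otimes> h)"
  by (simp add: lamplighter_def)

lemma empty_r_coset: "{} #> g = {}"
  by (simp add: r_coset_def)

lemma lamplighter_group: "group (lamplighter G H)"
proof (rule groupI)
  let ?K = "lamplighter G H"
  have one: "\<one>\<^bsub>?K\<^esub> = ({}, \<one>)" by (simp add: lamplighter_def)
  show "\<one>\<^bsub>?K\<^esub> \<in> carrier ?K"
    by (simp add: one lamplighter_carrier empty_in_lamps)
  show "x \<otimes>\<^bsub>?K\<^esub> y \<in> carrier ?K" if "x \<in> carrier ?K" "y \<in> carrier ?K" for x y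
    using that by (cases x; cases y)
      (simp add: lamplighter_carrier lamplighter_mult sym_diff_in_lamps r_coset_in_lamps)
  show "x \<otimes>\<^bsub>?K\<^esub> y \<otimes>\<^bsub>?K\<^esub> z = x \<otimes>\<^bsub>?K\<^esub> (y \<otimes>\<^bsub>?K\<^esub> z)"
    if xyz: "x \<in> carrier ?K" "y \<in> carrier ?K" "z \<in> carrier ?K" for x y z
  proof -
    obtain S g T h U k where eq: "x = (S, g)" "y = (T, h)" "z = (U, k)"
      by (metis surj_pair)
    have mem: "S \<in> lamps G H" "T \<in> lamps G H" "U \<in> lamps G H"
      "g \<in> carrier G" "h \<in> carrier G" "k \<in> carrier G"
      using xyz by (auto simp: eq lamplighter_carrier)
    have sub: "T \<subseteq> carrier G" "U \<subseteq> carrier G" "U #> inv h \<subseteq> carrier G"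
      using mem by (simp_all add: lamps_carrier r_coset_in_lamps)
    \<comment> \<open>The content of associativity in the lamp component: \<open>g\<close> moves
      both summands, and moving by \<open>h\<close> and then by \<open>g\<close> is moving by
      \<open>g \<otimes> h\<close>.\<close>
    have "sym_diff T (U #> inv h) #> inv g = sym_diff (T #> inv g) (U #> inv (g \<otimes> h))"
      using mem sub by (simp add: sym_diff_r_coset coset_mult_assoc inv_mult_group)
    then show ?thesis
      using mem by (auto simp: eq lamplighter_mult m_assoc)
  qed
  show "\<one>\<^bsub>?K\<^esub> \<otimes>\<^bsub>?K\<^esub> x = x" if "x \<in> carrier ?K" for x
    using that lamps_carrier
    by (cases x) (simp add: one lamplighter_carrier lamplighter_mult)
  show "\<exists>y\<in>carrier ?K. y \<otimes>\<^bsub>?K\<^esub> x = \<one>\<^bsub>?K\<^esub>" if x: "x \<in> carrier ?K" for x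
  proof -
    obtain S g where eq: "x = (S, g)" by fastforce
    \<comment> \<open>Translation by the inverse of \<open>inv g\<close> yields
      \<open>S #> g\<close> again, and every configuration is its own negative.\<close>
    then show ?thesis using x
      by (intro bexI[of _ "(S #> g, inv g)"])
        (auto simp: one lamplighter_carrier lamplighter_mult r_coset_in_lamps)
  qed
qed

lemma lamplighter_overgroup: "overgroup_via G (Pair {}) (lamplighter G H)"
  by (auto simp: overgroup_via_def lamplighter_group mon_def hom_def inj_on_def
      lamplighter_carrier lamplighter_mult empty_in_lamps empty_r_coset)

lemma lamplighter_finite_index:
  assumes "finite (rcosets H)"
  shows "finite_index (Pair {} ` carrier G) (lamplighter G H)"
proof -
  let ?K = "lamplighter G H" and ?G = "Pair {} ` carrier G :: ('a set \<times> 'a) set"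
  interpret K: group ?K by (rule lamplighter_group)
  interpret \<iota>: group_hom G ?K "Pair {}"
    using lamplighter_overgroup by unfold_locales (simp add: overgroup_via_def mon_def)
  have sub: "subgroup ?G ?K" by (rule \<iota>.img_is_subgroup)
  have "?G #>\<^bsub>?K\<^esub> (S, g) = ?G #>\<^bsub>?K\<^esub> (S #> g, \<one>)"
    if S: "S \<in> lamps G H" and g: "g \<in> carrier G" for S g
  proof -
    \<comment> \<open>The \<open>G\<close>-component splits off to the left, which leaves a coset
      representative with trivial \<open>G\<close>-component; hence there are at most as many cosets
      as configurations.\<close>
    have "(S, g) = ({}, g) \<otimes>\<^bsub>?K\<^esub> (S #> g, \<one>)"
      using S g lamps_carrier by (simp add: lamplighter_mult coset_mult_assoc)
    also have "?G #>\<^bsub>?K\<^esub> \<dots> = ?G #>\<^bsub>?K\<^esub> ({}, g) #>\<^bsub>?K\<^esub> (S #> g, \<one>)"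
      using S g by (intro K.coset_mult_assoc[symmetric] subgroup.subset[OF sub])
        (auto simp: lamplighter_carrier empty_in_lamps r_coset_in_lamps)
    also have "?G #>\<^bsub>?K\<^esub> ({}, g) = ?G"
      using g by (intro K.coset_join2 sub) (auto simp: lamplighter_carrier empty_in_lamps)
    finally show ?thesis .
  qed
  then have "rcosets\<^bsub>?K\<^esub> ?G \<subseteq> (\<lambda>S. ?G #>\<^bsub>?K\<^esub> (S, \<one>)) ` lamps G H"
    unfolding RCOSETS_def lamplighter_carrier by (blast intro: r_coset_in_lamps)
  then show ?thesis
    using sub finite_lamps[OF assms] unfolding finite_index_def
    by (blast intro: finite_subset)
qed

section \<open>Conjugacy of the marked elements\<close>

lemma lamplighter_conjugate_in:
  assumes x: "x \<in> H" and y: "y \<in> H" and conj: "conjugate_in (lamplighter G H) (H, x) (H, y)"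
  shows "conjugate_in (G\<lparr>carrier := H\<rparr>) x y"
proof -
  let ?K = "lamplighter G H"
  interpret K: group ?K by (rule lamplighter_group)
  obtain T g where Tg: "(T, g) \<in> carrier ?K"
    and eq: "(H, y) = (T, g) \<otimes>\<^bsub>?K\<^esub> (H, x) \<otimes>\<^bsub>?K\<^esub> inv\<^bsub>?K\<^esub> (T, g)"
    using conj by (auto simp: conjugate_in_def)
  have mem: "T \<in> lamps G H" "g \<in> carrier G" using Tg by (auto simp: lamplighter_carrier)
  have xyG: "x \<in> carrier G" "y \<in> carrier G" using x y subgroup.mem_carrier[OF H] by auto
  then have "(H, x) \<in> carrier ?K" "(H, y) \<in> carrier ?K"
    by (auto simp: lamplighter_carrier subgroup_in_lamps)
  then have "(H, y) \<otimes>\<^bsub>?K\<^esub> (T, g) = (T, g) \<otimes>\<^bsub>?K\<^esub> (H, x)"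
    using Tg eq by (simp add: K.m_assoc)
  then have S: "sym_diff H (T #> inv y) = sym_diff T (H #> inv g)" and yg: "y \<otimes> g = g \<otimes> x"
    by (auto simp: lamplighter_mult)
  \<comment> \<open>Membership of \<open>\<one>\<close> tells whether the lamp at the coset
    \<open>H\<close> is lit. Since \<open>y \<in> H\<close>, translating \<open>T\<close> by
    \<open>inv y\<close> leaves this lamp unchanged, so \<open>T\<close> contributes equally to both
    sides and cancels. Hence \<open>H #> inv g\<close> must have it lit, which means
    \<open>g \<in> H\<close>.\<close>
  have "\<one> \<in> sym_diff H (T #> inv y) \<longleftrightarrow> \<one> \<notin> T"
    using mem xyG y lamps_iff[OF mem(1) y one_closed] subgroup.one_closed[OF H]
    by (simp add: mem_r_coset_inv lamps_carrier)
  moreover have "\<one> \<in> sym_diff T (H #> inv g) \<longleftrightarrow> (\<one> \<in> T) \<noteq> (g \<in> H)"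
    using mem subgroup.subset[OF H] by (auto simp: mem_r_coset_inv)
  ultimately have gH: "g \<in> H" using S by auto
  have "y = g \<otimes> x \<otimes> inv g" using yg mem xyG by (metis inv_solve_right m_closed)
  then show ?thesis
    unfolding conjugate_in_def using gH m_inv_consistent[OF H gH] by (intro bexI[of _ g]) simp_all
qed

lemma lamplighter_not_conjugacy_separable:
  assumes ncs: "\<not> conjugacy_separable (G\<lparr>carrier := H\<rparr>)"
  shows "\<not> conjugacy_separable (lamplighter G H)"
proof
  let ?K = "lamplighter G H" and ?H = "G\<lparr>carrier := H\<rparr>"
  assume cs: "conjugacy_separable ?K"
  have HG: "h \<in> carrier G" if "h \<in> H" for h using that by (rule subgroup.mem_carrier[OF H])
  interpret K: group ?K by (rule lamplighter_group)
  obtain x y where xy: "x \<in> H" "y \<in> H" and nc: "\<not> conjugate_in ?H x y"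
    and sep: "\<And>(M :: nat monoid) \<phi>. group M \<Longrightarrow> finite (carrier M) \<Longrightarrow> \<phi> \<in> hom ?H M \<Longrightarrow>
      conjugate_in M (\<phi> x) (\<phi> y)"
    using ncs unfolding conjugacy_separable_def by auto
  have in_K: "(H, x) \<in> carrier ?K" "(H, y) \<in> carrier ?K"
    using xy HG by (auto simp: lamplighter_carrier subgroup_in_lamps)
  obtain M :: "nat monoid" and \<phi> where M: "group M" "finite (carrier M)" and \<phi>: "\<phi> \<in> hom ?K M"
    and ncM: "\<not> conjugate_in M (\<phi> (H, x)) (\<phi> (H, y))"
    using cs in_K nc lamplighter_conjugate_in[OF xy] unfolding conjugacy_separable_def by blast
  interpret M: group M by fact
  interpret \<phi>: group_hom ?K M \<phi> using \<phi> by unfold_locales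
  define \<psi> where "\<psi> = \<phi> \<circ> Pair {}"
  have \<iota>: "Pair {} \<in> hom G ?K"
    using lamplighter_overgroup by (simp add: overgroup_via_def mon_def)
  then have \<psi>G: "\<psi> \<in> hom G M"
    unfolding \<psi>_def using \<phi> by (rule Group.hom_compose)
  then interpret \<psi>: group_hom G M \<psi> by unfold_locales
  \<comment> \<open>\<open>sep\<close> is applied to the image of \<open>H\<close> and not to
    \<open>M\<close> itself, so that the conjugator has the form \<open>\<psi> h\<close> with
    \<open>h \<in> H\<close>.\<close>
  let ?I = "M\<lparr>carrier := \<psi> ` H\<rparr>"
  have sub: "subgroup (\<psi> ` H) M" by (rule \<psi>.subgroup_img_is_subgroup[OF H])
  have "conjugate_in ?I (\<psi> x) (\<psi> y)"
  proof (rule sep)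
    show "group ?I" by (rule M.subgroup_imp_group[OF sub])
    show "finite (carrier ?I)" using M(2) subgroup.subset[OF sub] by (auto intro: finite_subset)
    show "\<psi> \<in> hom ?H ?I" using HG by (auto simp: hom_def)
  qed
  then obtain h where h: "h \<in> H" and "\<psi> y = \<psi> h \<otimes>\<^bsub>M\<^esub> \<psi> x \<otimes>\<^bsub>M\<^esub> inv\<^bsub>?I\<^esub> \<psi> h"
    by (auto simp: conjugate_in_def)
  then have eq: "\<psi> y \<otimes>\<^bsub>M\<^esub> \<psi> h = \<psi> h \<otimes>\<^bsub>M\<^esub> \<psi> x"
    using xy HG M.m_inv_consistent[OF sub] by (simp add: M.m_assoc)
  have in_K': "({}, k) \<in> carrier ?K" "(H, \<one>) \<in> carrier ?K" if "k \<in> H" for k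
    using that HG by (auto simp: lamplighter_carrier subgroup_in_lamps empty_in_lamps)
  have split: "\<phi> (H, k) = \<phi> (H, \<one>) \<otimes>\<^bsub>M\<^esub> \<psi> k" if "k \<in> H" for k
  proof -
    have "(H, k) = (H, \<one>) \<otimes>\<^bsub>?K\<^esub> ({}, k)"
      using that HG by (simp add: lamplighter_mult empty_r_coset)
    then show ?thesis using in_K'[OF that] by (simp add: \<psi>_def)
  qed
  have "\<psi> h \<otimes>\<^bsub>M\<^esub> \<phi> (H, \<one>) = \<phi> (({}, h) \<otimes>\<^bsub>?K\<^esub> (H, \<one>))"
    using in_K'[OF h] by (simp add: \<psi>_def)
  \<comment> \<open>\<open>H #> inv h = H\<close> because \<open>inv h \<in> H\<close>: the lit lamp
    is fixed by \<open>h\<close>, so the two commute.\<close>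
  also have "({}, h) \<otimes>\<^bsub>?K\<^esub> (H, \<one>) = (H, h)"
    using h HG coset_join2[of "inv h" H] H subgroup.m_inv_closed[OF H]
    by (simp add: lamplighter_mult)
  also note split[OF h]
  finally have comm: "\<psi> h \<otimes>\<^bsub>M\<^esub> \<phi> (H, \<one>) = \<phi> (H, \<one>) \<otimes>\<^bsub>M\<^esub> \<psi> h" .
  have c: "\<phi> (H, \<one>) \<in> carrier M" using in_K'[OF h] by simp
  have in_M: "\<psi> k \<in> carrier M" if "k \<in> H" for k using HG[OF that] by simp
  \<comment> \<open>\<open>\<psi> h\<close> commutes with the image of the lit lamp and conjugates
    \<open>\<psi> x\<close> to \<open>\<psi> y\<close>, so by \<open>split\<close> it conjugates the
    images of the marked elements.\<close>
  have "\<psi> h \<otimes>\<^bsub>M\<^esub> \<phi> (H, x) = \<psi> h \<otimes>\<^bsub>M\<^esub> \<phi> (H, \<one>) \<otimes>\<^bsub>M\<^esub> \<psi> x"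
    unfolding split[OF xy(1)] using c in_M h xy by (simp only: M.m_assoc)
  also have "\<dots> = \<phi> (H, \<one>) \<otimes>\<^bsub>M\<^esub> (\<psi> h \<otimes>\<^bsub>M\<^esub> \<psi> x)"
    unfolding comm using c in_M h xy by (simp only: M.m_assoc)
  also have "\<dots> = \<phi> (H, y) \<otimes>\<^bsub>M\<^esub> \<psi> h"
    unfolding split[OF xy(2)] eq[symmetric] using c in_M h xy by (simp only: M.m_assoc)
  finally have "\<phi> (H, y) = \<psi> h \<otimes>\<^bsub>M\<^esub> \<phi> (H, x) \<otimes>\<^bsub>M\<^esub> inv\<^bsub>M\<^esub> \<psi> h"
    by (rule M.inv_solve_right[THEN iffD2, rotated 3])
      (use in_K in_M[OF h] in auto)
  then have "conjugate_in M (\<phi> (H, x)) (\<phi> (H, y))"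
    unfolding conjugate_in_def using in_M[OF h] by (rule rev_bexI[rotated])
  with ncM show False by contradiction
qed

end

end

theorem corollary1p5:
  fixes G :: "('a, 'm) monoid_scheme"
  assumes "group G"
    and "\<not> hereditarily_conjugacy_separable G"
  shows "\<exists>(K :: ('a \<times> nat) monoid) \<iota>. overgroup_via G \<iota> K \<and>
           finite_index (\<iota> ` carrier G) K \<and> \<not> conjugacy_separable K"
proof -
  interpret group G by fact
  obtain H where "subgroup H G" "finite (rcosets\<^bsub>G\<^esub> H)"
    "\<not> conjugacy_separable (G\<lparr>carrier := H\<rparr>)"
    using assms(2) by (auto simp: hereditarily_conjugacy_separable_def finite_index_def)
  then show ?thesis
    by (intro finite_index_overgroup_on_prod_nat[of G "Pair {}" "lamplighter G H"]
        lamplighter_overgroup lamplighter_finite_index lamplighter_not_conjugacy_separable)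
qed

end
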